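(* Let $\mu > 0$. There exists $\delta = \delta(\mu) > 0$ such that for every positive integer $N$ and every subset $R \subseteq [-N,N]^2$ with density $|R|/(2N+1)^2 \ge \mu$ the following holds: if $A_1,B_1,A_2,B_2$ are i.i.d. uniform in $[-N,N]$, then $$\Pr\left[(A_1,B_1) \in R \land (A_2,B_2) \in R \land (A_1+B_1-B_2,\ A_2+B_2-A_1) \in R\right] \ge \delta .$$
   Context: For $N>0$, $[-N,N]$ denotes the set of integers $\{n \in \mathbb{Z} : |n| \le N\}$. *)

theory Defs
  imports "HOL-Probability.Probability"
begin

definition sym_interval :: "nat \<Rightarrow> int set" where
  "sym_interval N = {n. \<bar>n\<bar> \<le> int N}"

text \<open>The joint law of four independent variables, each uniform on the interval.
  \<^const>\<open>pmf_of_set\<close> is meaningful only for finite nonempty sets; see below.\<close>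

definition iid_uniform4 :: "nat \<Rightarrow> (int \<times> int \<times> int \<times> int) pmf" where
  "iid_uniform4 N =
     (let U = pmf_of_set (sym_interval N) in pair_pmf U (pair_pmf U (pair_pmf U U)))"

lemma sym_interval_eq: "sym_interval N = {- int N..int N}"
  by (auto simp: sym_interval_def)

lemma finite_sym_interval [simp]: "finite (sym_interval N)"
  by (simp add: sym_interval_eq)

lemma sym_interval_nonempty [simp]: "sym_interval N \<noteq> {}"
  by (simp add: sym_interval_eq)

end

theory Submission
  imports Defs "HOL-Library.Real_Mod"
begin

text \<open>
  With \<open>P\<^sub>i = (A\<^sub>i, B\<^sub>i)\<close> the third point is \<open>M P\<^sub>1 + (I - M) P\<^sub>2\<close>, where \<open>M (a, b) = (a + b, - a)\<close>
  satisfies \<open>M\<^sup>2 - M + I = 0\<close>: the three points form an equilateral triangle in the Eisenstein lattice.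
  The map \<open>(a, b) \<mapsto> K a + b\<close> into the integers modulo \<open>m = K\<^sup>2 - K + 1\<close> turns \<open>M\<close> into multiplication
  by \<open>K\<close>, and for \<open>K = 10 N\<close> it is injective on the boxes involved. It therefore suffices to bound from
  below the number of solutions of \<open>w = \<lambda> u + (1 - \<lambda>) v\<close> in a dense set modulo \<open>m\<close>, where
  \<open>\<lambda>\<close> and \<open>1 - \<lambda>\<close> are units.

  For this, split the indicator function \<open>f\<close> by the size of its Fourier coefficients, with two
  thresholds chosen so that the intermediate coefficients carry little energy (among many scales one
  works) and the lower threshold is tiny compared with the density of a Bohr set \<open>B\<close> attached to the
  large coefficients. For \<open>u, v \<in> t + B\<close> the large part of \<open>f\<close> is almost constant, so \<open>f w\<close>
  may be replaced by the average of \<open>f\<close> over \<open>t + B\<close>; this leaves the mean of the cube of that local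
  average, which is at least the cube of the density.
\<close>

subsection \<open>Fourier analysis modulo m\<close>

definition chi :: "int \<Rightarrow> int \<Rightarrow> complex" where
  "chi m n = cis (2 * pi * of_int n / of_int m)"

lemma chi_0 [simp]: "chi m 0 = 1"
  by (simp add: chi_def)

lemma norm_chi [simp]: "cmod (chi m n) = 1"
  by (simp add: chi_def)

lemma chi_add: "chi m (a + b) = chi m a * chi m b"
  by (simp add: chi_def cis_mult ring_distribs add_divide_distrib)

lemma cnj_chi: "cnj (chi m n) = chi m (- n)"
  by (simp add: chi_def cis_cnj)

lemma chi_eq_1_iff:
  assumes "m > 0"
  shows "chi m n = 1 \<longleftrightarrow> m dvd n"
proof -
  have "chi m n = 1 \<longleftrightarrow> (\<exists>k::int. 2 * pi * of_int n / of_int m = of_int k * (2 * pi))"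
    by (simp add: chi_def cis_eq_1_iff)
  also have "\<dots> \<longleftrightarrow> (\<exists>k::int. n = m * k)"
  proof (intro ex_cong1)
    fix k :: int
    have "2 * pi * of_int n / of_int m = of_int k * (2 * pi) \<longleftrightarrow>
        (of_int n :: real) = of_int m * of_int k"
      using assms by (auto simp: field_simps)
    also have "\<dots> \<longleftrightarrow> n = m * k"
      by (metis of_int_eq_iff of_int_mult)
    finally show "2 * pi * of_int n / of_int m = of_int k * (2 * pi) \<longleftrightarrow> n = m * k" .
  qed
  finally show ?thesis
    by (auto simp: dvd_def)
qed

lemma chi_mod:
  assumes "m > 0"
  shows "chi m (n mod m) = chi m n"
proof -
  have "chi m n = chi m (n mod m + m * (n div m))"
    by simp
  also have "\<dots> = chi m (n mod m)"
    unfolding chi_add using chi_eq_1_iff[OF assms, of "m * (n div m)"] by simp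
  finally show ?thesis ..
qed

lemma norm_chi_minus_1_le:
  assumes "m > 0"
  shows "cmod (chi m n - 1) \<le> 2 * pi * \<bar>of_int n\<bar> / of_int m"
proof -
  have "cmod (chi m n - 1) = 2 * \<bar>sin ((2 * pi * of_int n / of_int m) / 2)\<bar>"
    unfolding chi_def cis_conv_exp by (rule dist_exp_i_1)
  also have "\<dots> \<le> 2 * \<bar>(2 * pi * of_int n / of_int m) / 2\<bar>"
    by (intro mult_left_mono abs_sin_x_le_abs_x) auto
  finally show ?thesis
    using assms by (simp add: abs_mult)
qed

lemma sum_shift_mod:
  fixes F :: "int \<Rightarrow> 'a::comm_monoid_add"
  assumes "m > 0" and periodic: "\<And>x. F (x mod m) = F x"
  shows "(\<Sum>x\<in>{0..<m}. F (x + t)) = (\<Sum>x\<in>{0..<m}. F x)"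
proof -
  have "bij_betw (\<lambda>x. (x + t) mod m) {0..<m} {0..<m}"
    by (rule bij_betw_byWitness[where f' = "\<lambda>x. (x - t) mod m"])
      (use assms in \<open>auto simp: mod_simps\<close>)
  then have "(\<Sum>x\<in>{0..<m}. F ((x + t) mod m)) = (\<Sum>x\<in>{0..<m}. F x)"
    by (rule sum.reindex_bij_betw)
  then show ?thesis
    by (simp add: periodic)
qed

text \<open>Shifting the summation by 1 multiplies the sum by \<open>chi m c\<close>, which differs
  from 1 unless m divides c.\<close>

lemma sum_chi:
  assumes "m > 0"
  shows "(\<Sum>k\<in>{0..<m}. chi m (c * k)) = (if m dvd c then of_int m else 0)"
proof (cases "m dvd c")
  case True
  then have "chi m (c * k) = 1" for k
    using chi_eq_1_iff[OF assms] by simp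
  then show ?thesis
    using True assms by simp
next
  case False
  let ?s = "\<Sum>k\<in>{0..<m}. chi m (c * k)"
  have "?s = (\<Sum>k\<in>{0..<m}. chi m (c * (k + 1)))"
  proof (rule sum_shift_mod[OF assms, symmetric])
    show "chi m (c * (x mod m)) = chi m (c * x)" for x
      by (metis assms chi_mod mod_mult_right_eq)
  qed
  also have "\<dots> = chi m c * ?s"
    by (simp add: ring_distribs chi_add sum_distrib_left mult.commute)
  finally have "(chi m c - 1) * ?s = 0"
    by (simp add: algebra_simps)
  then show ?thesis
    using False chi_eq_1_iff[OF assms, of c] by simp
qed

text \<open>The points of \<open>D\<close> are pairwise incongruent modulo m and stay so after
  multiplication by the unit c, so orthogonality leaves only the diagonal. The multiplier c serves
  the dilations by \<open>lam\<close> and \<open>1 - lam\<close>; \<open>D\<close> may also be a set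
  of frequencies.\<close>

lemma parseval:
  assumes m: "m > 0" and c: "coprime c m" and D: "D \<subseteq> {0..<m}"
  shows "(\<Sum>k\<in>{0..<m}. (cmod (\<Sum>d\<in>D. a d * chi m (c * k * d)))\<^sup>2) = of_int m * (\<Sum>d\<in>D. (cmod (a d))\<^sup>2)"
proof -
  have fin: "finite D"
    using D finite_subset by blast
  have orth: "(\<Sum>k\<in>{0..<m}. chi m (c * k * d) * chi m (- (c * k * d'))) = (if d = d' then of_int m else 0)"
    if "d \<in> D" "d' \<in> D" for d d'
  proof -
    have "(\<Sum>k\<in>{0..<m}. chi m (c * k * d) * chi m (- (c * k * d'))) = (\<Sum>k\<in>{0..<m}. chi m ((c * (d - d')) * k))"
      by (intro sum.cong refl, subst chi_add[symmetric]) (simp add: algebra_simps)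
    also have "\<dots> = (if m dvd c * (d - d') then of_int m else 0)"
      by (rule sum_chi[OF m])
    also have "m dvd c * (d - d') \<longleftrightarrow> d = d'"
    proof
      assume "m dvd c * (d - d')"
      then have "m dvd d - d'"
        using c by (simp add: coprime_commute coprime_dvd_mult_right_iff)
      moreover have "\<bar>d - d'\<bar> < m"
        using that D by (simp add: abs_less_iff subset_iff) (smt (verit))
      ultimately show "d = d'"
        using dvd_imp_le_int[of "d - d'" m] m by auto
    qed auto
    finally show ?thesis .
  qed
  have "complex_of_real (\<Sum>k\<in>{0..<m}. (cmod (\<Sum>d\<in>D. a d * chi m (c * k * d)))\<^sup>2)
      = (\<Sum>k\<in>{0..<m}. \<Sum>d\<in>D. \<Sum>d'\<in>D. a d * cnj (a d') * (chi m (c * k * d) * chi m (- (c * k * d'))))"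
    unfolding of_real_sum complex_norm_square cnj_sum complex_cnj_mult cnj_chi sum_product
    by (intro sum.cong refl) (simp add: mult_ac)
  also have "\<dots> = (\<Sum>d\<in>D. \<Sum>d'\<in>D. a d * cnj (a d') * (\<Sum>k\<in>{0..<m}. chi m (c * k * d) * chi m (- (c * k * d'))))"
    by (simp add: sum_distrib_left sum.swap[of _ "{0..<m}"])
  also have "\<dots> = (\<Sum>d\<in>D. \<Sum>d'\<in>D. a d * cnj (a d') * (if d = d' then of_int m else 0))"
    by (intro sum.cong refl) (simp add: orth)
  also have "\<dots> = (\<Sum>d\<in>D. a d * cnj (a d) * of_int m)"
    using fin by (intro sum.cong refl) (simp add: if_distrib sum.delta cong: if_cong)
  also have "\<dots> = complex_of_real (of_int m * (\<Sum>d\<in>D. (cmod (a d))\<^sup>2))"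
    unfolding of_real_mult of_real_sum complex_norm_square sum_distrib_left
    by (intro sum.cong refl) (simp add: mult_ac)
  finally show ?thesis
    unfolding of_real_eq_iff .
qed

section \<open>Fourier coefficients, partial sums and energy\<close>

definition fourier :: "int \<Rightarrow> (int \<Rightarrow> real) \<Rightarrow> int \<Rightarrow> complex" where
  "fourier m f k = (\<Sum>x\<in>{0..<m}. of_real (f x) * chi m (- (k * x))) / of_int m"

definition fpart :: "int \<Rightarrow> (int \<Rightarrow> real) \<Rightarrow> int set \<Rightarrow> int \<Rightarrow> complex" where
  "fpart m f K x = (\<Sum>k\<in>K. fourier m f k * chi m (k * x))"

lemma fpart_union:
  assumes "finite K" "finite L" "K \<inter> L = {}"
  shows "fpart m f (K \<union> L) x = fpart m f K x + fpart m f L x"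
  using assms by (simp add: fpart_def sum.union_disjoint)

lemma fourier_inversion:
  assumes m: "m > 0" and periodic: "\<And>x. f (x mod m) = f x"
  shows "fpart m f {0..<m} x = of_real (f x)"
proof -
  have "of_int m * fpart m f {0..<m} x = (\<Sum>k\<in>{0..<m}. \<Sum>y\<in>{0..<m}. of_real (f y) * chi m ((x - y) * k))"
    using m unfolding fpart_def fourier_def sum_distrib_left sum_distrib_right sum_divide_distrib
    by (intro sum.cong refl) (simp add: mult.assoc chi_add[symmetric], simp add: algebra_simps)
  also have "\<dots> = (\<Sum>y\<in>{0..<m}. of_real (f y) * (\<Sum>k\<in>{0..<m}. chi m ((x - y) * k)))"
    by (subst sum.swap) (simp add: sum_distrib_left)
  also have "\<dots> = (\<Sum>y\<in>{0..<m}. if y = x mod m then of_int m * of_real (f y) else 0)"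
  proof (intro sum.cong refl)
    fix y assume "y \<in> {0..<m}"
    then have "m dvd x - y \<longleftrightarrow> y = x mod m"
      by (metis atLeastLessThan_iff mod_eq_dvd_iff mod_pos_pos_trivial)
    then show "of_real (f y) * (\<Sum>k\<in>{0..<m}. chi m ((x - y) * k))
        = (if y = x mod m then of_int m * of_real (f y) else 0)"
      by (simp add: sum_chi[OF m])
  qed
  also have "\<dots> = of_int m * of_real (f x)"
    using m by (simp add: sum.delta periodic)
  finally show ?thesis
    using m by simp
qed

text \<open>The normalisation by 1/m makes the energy the mean of the squares of f, hence at most 1
  for f with values in [0, 1], whatever m is.\<close>

lemma sum_norm_fourier:
  assumes m: "m > 0" 
  shows "(\<Sum>k\<in>{0..<m}. (cmod (fourier m f k))\<^sup>2) = (\<Sum>x\<in>{0..<m}. (f x)\<^sup>2) / of_int m"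
proof -
  have "(\<Sum>k\<in>{0..<m}. (cmod (fourier m f k))\<^sup>2)
      = (\<Sum>k\<in>{0..<m}. (cmod (\<Sum>x\<in>{0..<m}. of_real (f x) * chi m ((- 1) * k * x)))\<^sup>2) / (of_int m)\<^sup>2"
    using m by (simp add: fourier_def norm_divide power_divide flip: sum_divide_distrib)
  also have "\<dots> = (of_int m * (\<Sum>x\<in>{0..<m}. (f x)\<^sup>2)) / (of_int m)\<^sup>2"
    by (subst parseval[OF m]) auto
  finally show ?thesis
    using m by (simp add: power2_eq_square)
qed

subsection \<open>Bohr sets\<close>

text \<open>Dirichlet's pigeonhole argument: sort the residues d by which of n equal arcs contains
  each fraction q d / m modulo 1. One of the n^|Q| possible classes is large, and multiplied by any
  q in Q, differences within a class are near 0 modulo m.\<close>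

lemma bohr_set:
  assumes m: "m > 0" and n: "n > (0::nat)" and Q: "finite Q"
  obtains B where "B \<subseteq> {0..<m}" "m \<le> int (card B * n ^ card Q)"
    "\<And>q d. q \<in> Q \<Longrightarrow> d \<in> B \<Longrightarrow> cmod (chi m (q * d) - 1) \<le> 2 * pi / real n"
proof -
  define g where "g d = restrict (\<lambda>q. (int n * ((q * d) mod m)) div m) Q" for d
  have "g \<in> {0..<m} \<rightarrow> (Q \<rightarrow>\<^sub>E {0..<int n})"
  proof (rule Pi_I)
    fix d
    have "(int n * ((q * d) mod m)) div m < int n" for q
    proof -
      have "m * ((int n * ((q * d) mod m)) div m) \<le> int n * ((q * d) mod m)"
        using m by (simp add: minus_mod_eq_mult_div[symmetric])
      also have "\<dots> < int n * m"
        using m n by (intro mult_strict_left_mono) auto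
      finally show ?thesis
        using m by (simp add: mult.commute)
    qed
    then have "(int n * ((q * d) mod m)) div m \<in> {0..<int n}" for q
      using m n by (auto simp: pos_imp_zdiv_nonneg_iff)
    then show "g d \<in> (Q \<rightarrow>\<^sub>E {0..<int n})"
      by (auto simp: g_def)
  qed
  then obtain y where "card {0..<m} \<le> card (g -` {y} \<inter> {0..<m}) * card (Q \<rightarrow>\<^sub>E {0..<int n})"
    using pigeonhole_card[of g "{0..<m}" "Q \<rightarrow>\<^sub>E {0..<int n}"] n Q
    by (auto simp: finite_PiE PiE_eq_empty_iff)
  moreover define C where "C = g -` {y} \<inter> {0..<m}"
  ultimately have C: "m \<le> int (card C * n ^ card Q)"
    using Q m by (simp add: card_PiE nat_le_iff)
  then have "C \<noteq> {}"
    using m by auto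
  then obtain z where z: "z \<in> C"
    by blast
  \<comment> \<open>Differences with one fixed member of the class: this is a translate modulo m, so
    it keeps the cardinality.\<close>
  define B where "B = (\<lambda>d. (d - z) mod m) ` C"
  have "inj_on (\<lambda>d. (d - z) mod m) C"
  proof (rule inj_onI)
    fix d d' assume "d \<in> C" "d' \<in> C" "(d - z) mod m = (d' - z) mod m"
    moreover have "((d - z) mod m + z) mod m = d mod m" "((d' - z) mod m + z) mod m = d' mod m"
      by (simp_all add: mod_simps)
    ultimately show "d = d'"
      unfolding C_def by (metis IntD2 atLeastLessThan_iff mod_pos_pos_trivial)
  qed
  then have "card B = card C"
    unfolding B_def by (rule card_image)
  show thesis
  proof
    show "B \<subseteq> {0..<m}"
      using m by (auto simp: B_def)
    show "m \<le> int (card B * n ^ card Q)"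
      using C \<open>card B = card C\<close> by simp
  next
    fix q d assume q: "q \<in> Q" and "d \<in> B"
    then obtain x where x: "x \<in> C" "d = (x - z) mod m"
      by (auto simp: B_def)
    define r where "r = (q * x) mod m - (q * z) mod m"
    have "g x = g z"
      using x z by (auto simp: C_def)
    then have "g x q = g z q"
      by simp
    then have "(int n * ((q * x) mod m)) div m = (int n * ((q * z) mod m)) div m"
      using q by (simp add: g_def)
    \<comment> \<open>With equal quotients by m, the two multiples differ by the difference of their
      remainders, which is less than m in absolute value.\<close>
    then have "int n * ((q * x) mod m) - int n * ((q * z) mod m)
        = (int n * ((q * x) mod m)) mod m - (int n * ((q * z) mod m)) mod m"
      by (simp add: minus_div_mult_eq_mod[symmetric])
    moreover have "0 \<le> a mod m" "a mod m < m" for a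
      using m by simp_all
    ultimately have "\<bar>int n * r\<bar> \<le> m"
      unfolding r_def right_diff_distrib by (smt (verit))
    then have "real_of_int \<bar>int n * r\<bar> \<le> of_int m"
      unfolding of_int_le_iff .
    then have r: "real n * \<bar>of_int r\<bar> \<le> of_int m"
      by (simp add: abs_mult)
    have "(q * d) mod m = r mod m"
      unfolding x r_def by (simp add: mod_simps right_diff_distrib)
    then have "chi m (q * d) = chi m r"
      by (metis chi_mod m)
    then have "cmod (chi m (q * d) - 1) \<le> 2 * pi * \<bar>of_int r\<bar> / of_int m"
      using norm_chi_minus_1_le[OF m] by simp
    also have "\<dots> \<le> 2 * pi / real n"
      using m n r by (simp add: field_simps)
    finally show "cmod (chi m (q * d) - 1) \<le> 2 * pi / real n" .
  qed
qed

subsection \<open>Counting in translates of a Bohr set\<close>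

text \<open>A uniform bound on c combined with |X Y| <= (|X|^2 + |Y|^2) / 2. This stands in for
  Cauchy-Schwarz, since the applications give both energies the same bound.\<close>

lemma norm_sum_triple_le:
  fixes c X Y :: "'a \<Rightarrow> complex"
  assumes "finite Z" "K \<subseteq> Z" and c: "\<And>k. k \<in> K \<Longrightarrow> cmod (c k) \<le> \<epsilon>" and "\<epsilon> \<ge> 0"
  shows "cmod (\<Sum>k\<in>K. c k * X k * Y k) \<le> \<epsilon> / 2 * ((\<Sum>k\<in>Z. (cmod (X k))\<^sup>2) + (\<Sum>k\<in>Z. (cmod (Y k))\<^sup>2))"
proof -
  have "cmod (\<Sum>k\<in>K. c k * X k * Y k) \<le> (\<Sum>k\<in>K. \<epsilon> / 2 * ((cmod (X k))\<^sup>2 + (cmod (Y k))\<^sup>2))"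
  proof (rule sum_norm_le)
    fix k assume "k \<in> K"
    have "cmod (c k * X k * Y k) \<le> \<epsilon> * (cmod (X k) * cmod (Y k))"
      using c[OF \<open>k \<in> K\<close>] by (simp add: norm_mult mult.assoc mult_right_mono)
    also have "\<dots> \<le> \<epsilon> * (((cmod (X k))\<^sup>2 + (cmod (Y k))\<^sup>2) / 2)"
      using \<open>\<epsilon> \<ge> 0\<close> sum_squares_bound[of "cmod (X k)" "cmod (Y k)"] by (intro mult_left_mono) auto
    finally show "cmod (c k * X k * Y k) \<le> \<epsilon> / 2 * ((cmod (X k))\<^sup>2 + (cmod (Y k))\<^sup>2)"
      by simp
  qed
  also have "\<dots> \<le> (\<Sum>k\<in>Z. \<epsilon> / 2 * ((cmod (X k))\<^sup>2 + (cmod (Y k))\<^sup>2))"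
    using assms by (intro sum_mono2) auto
  finally show ?thesis
    unfolding sum_distrib_left[symmetric] sum.distrib .
qed

text \<open>Because the weight is a product, for each frequency k the double sum factors into a sum
  over d1 and one over d2. As \<open>lam\<close> and \<open>1 - lam\<close> are units, Parseval
  bounds the energy of either factor by m |B|.\<close>

lemma bilinear_fpart_le:
  assumes m: "m > 0" and lam: "coprime lam m" "coprime (1 - lam) m"
    and B: "B \<subseteq> {0..<m}" and K: "K \<subseteq> {0..<m}" and "\<epsilon> \<ge> 0"
    and uniform: "\<And>k. k \<in> K \<Longrightarrow> cmod (fourier m f k) \<le> \<epsilon>"
    and a: "\<And>d. d \<in> B \<Longrightarrow> cmod (a d) \<le> 1"
  shows "cmod (\<Sum>d1\<in>B. \<Sum>d2\<in>B. a d1 * a d2 * fpart m f K (t + lam * d1 + (1 - lam) * d2))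
    \<le> \<epsilon> * of_int m * real (card B)"
proof -
  define X where "X c k = (\<Sum>d\<in>B. a d * chi m (c * k * d))" for c k
  have X: "(\<Sum>k\<in>{0..<m}. (cmod (X c k))\<^sup>2) \<le> of_int m * real (card B)" if "coprime c m" for c
  proof -
    have "(\<Sum>d\<in>B. (cmod (a d))\<^sup>2) \<le> (\<Sum>d\<in>B. 1)"
      using a by (intro sum_mono) (simp add: power_le_one)
    then show ?thesis
      using m unfolding X_def parseval[OF m that B] by (intro mult_left_mono) auto
  qed
  have "(\<Sum>d1\<in>B. \<Sum>d2\<in>B. a d1 * a d2 * fpart m f K (t + lam * d1 + (1 - lam) * d2))
      = (\<Sum>d1\<in>B. \<Sum>d2\<in>B. \<Sum>k\<in>K. (fourier m f k * chi m (k * t)) * (a d1 * chi m (lam * k * d1)) * (a d2 * chi m ((1 - lam) * k * d2)))"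
    unfolding fpart_def sum_distrib_left
    by (intro sum.cong refl) (simp add: distrib_left chi_add mult_ac)
  also have "\<dots> = (\<Sum>k\<in>K. \<Sum>d1\<in>B. \<Sum>d2\<in>B. (fourier m f k * chi m (k * t)) * (a d1 * chi m (lam * k * d1)) * (a d2 * chi m ((1 - lam) * k * d2)))"
    by (simp add: sum.swap[of _ K])
  also have "\<dots> = (\<Sum>k\<in>K. (fourier m f k * chi m (k * t)) * X lam k * X (1 - lam) k)"
    unfolding X_def
    by (simp add: sum_product sum_distrib_left sum_distrib_right mult.assoc) (rule sum.cong[OF refl], rule sum.swap)
  also have "cmod \<dots> \<le> \<epsilon> / 2 * ((\<Sum>k\<in>{0..<m}. (cmod (X lam k))\<^sup>2) + (\<Sum>k\<in>{0..<m}. (cmod (X (1 - lam) k))\<^sup>2))"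
    using K uniform \<open>\<epsilon> \<ge> 0\<close> by (intro norm_sum_triple_le) (auto simp: norm_mult)
  also have "\<dots> \<le> \<epsilon> / 2 * (of_int m * real (card B) + of_int m * real (card B))"
    using \<open>\<epsilon> \<ge> 0\<close> X lam by (intro mult_left_mono add_mono) auto
  finally show ?thesis
    by (simp add: algebra_simps)
qed

text \<open>The same factorisation, with t running over all residues as one of the two variables;
  |B| <= m gives both energies the bound m^2.\<close>

lemma linear_fpart_le:
  assumes m: "m > 0" and B: "B \<subseteq> {0..<m}" and K: "K \<subseteq> {0..<m}" and "\<epsilon> \<ge> 0"
    and uniform: "\<And>k. k \<in> K \<Longrightarrow> cmod (fourier m f k) \<le> \<epsilon>"
    and a: "\<And>t. cmod (a t) \<le> 1"
  shows "cmod (\<Sum>t\<in>{0..<m}. a t * (\<Sum>d\<in>B. fpart m f K (t + d))) \<le> \<epsilon> * (of_int m)\<^sup>2"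
proof -
  define X where "X k = (\<Sum>t\<in>{0..<m}. a t * chi m (1 * k * t))" for k
  define Y where "Y k = (\<Sum>d\<in>B. 1 * chi m (1 * k * d))" for k
  have X: "(\<Sum>k\<in>{0..<m}. (cmod (X k))\<^sup>2) \<le> (of_int m)\<^sup>2"
  proof -
    have "(\<Sum>t\<in>{0..<m}. (cmod (a t))\<^sup>2) \<le> (\<Sum>t\<in>{0..<m}. 1)"
      using a by (intro sum_mono) (simp add: power_le_one)
    then show ?thesis
      unfolding X_def power2_eq_square[of "of_int m"] using m by (subst parseval[OF m]) auto
  qed
  have "real (card B) \<le> of_int m"
    using card_mono[OF _ B] m by auto
  then have Y: "(\<Sum>k\<in>{0..<m}. (cmod (Y k))\<^sup>2) \<le> (of_int m)\<^sup>2"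
    unfolding Y_def power2_eq_square[of "of_int m"] using m B by (subst parseval[OF m]) auto
  have "(\<Sum>t\<in>{0..<m}. a t * (\<Sum>d\<in>B. fpart m f K (t + d)))
      = (\<Sum>t\<in>{0..<m}. \<Sum>d\<in>B. \<Sum>k\<in>K. fourier m f k * (a t * chi m (k * t)) * chi m (k * d))"
    unfolding fpart_def sum_distrib_left
    by (intro sum.cong refl) (simp add: distrib_left chi_add mult_ac)
  also have "\<dots> = (\<Sum>k\<in>K. \<Sum>t\<in>{0..<m}. \<Sum>d\<in>B. fourier m f k * (a t * chi m (k * t)) * chi m (k * d))"
    by (simp add: sum.swap[of _ K])
  also have "\<dots> = (\<Sum>k\<in>K. fourier m f k * X k * Y k)"
    unfolding X_def Y_def
    by (simp add: sum_product sum_distrib_left sum_distrib_right mult.assoc) (rule sum.cong[OF refl], rule sum.swap)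
  also have "cmod \<dots> \<le> \<epsilon> / 2 * ((\<Sum>k\<in>{0..<m}. (cmod (X k))\<^sup>2) + (\<Sum>k\<in>{0..<m}. (cmod (Y k))\<^sup>2))"
    using K uniform \<open>\<epsilon> \<ge> 0\<close> by (intro norm_sum_triple_le) auto
  also have "\<dots> \<le> \<epsilon> / 2 * ((of_int m)\<^sup>2 + (of_int m)\<^sup>2)"
    using \<open>\<epsilon> \<ge> 0\<close> X Y by (intro mult_left_mono add_mono) auto
  finally show ?thesis
    by simp
qed

lemma fpart_mod:
  assumes "m > 0"
  shows "fpart m f K (x mod m) = fpart m f K x"
proof -
  have "chi m (k * (x mod m)) = chi m (k * x)" for k
    by (metis assms chi_mod mod_mult_right_eq)
  then show ?thesis
    by (simp add: fpart_def)
qed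

text \<open>Parseval with frequencies in the role of points gives the mean square of the partial
  sum, and Cauchy-Schwarz passes to the mean of its modulus. Periodicity allows the shift by
  s.\<close>

lemma sum_norm_fpart_le:
  assumes m: "m > 0" and K: "K \<subseteq> {0..<m}" and "\<sigma> \<ge> 0"
    and energy: "(\<Sum>k\<in>K. (cmod (fourier m f k))\<^sup>2) \<le> \<sigma>\<^sup>2"
  shows "(\<Sum>t\<in>{0..<m}. cmod (fpart m f K (t + s))) \<le> of_int m * \<sigma>"
proof -
  have "(\<Sum>t\<in>{0..<m}. (cmod (fpart m f K t))\<^sup>2) = of_int m * (\<Sum>k\<in>K. (cmod (fourier m f k))\<^sup>2)"
    using parseval[OF m _ K, of 1 "fourier m f"] by (simp add: fpart_def mult.commute)
  also have "\<dots> \<le> of_int m * \<sigma>\<^sup>2"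
    using energy m by (intro mult_left_mono) auto
  finally have "(\<Sum>t\<in>{0..<m}. (cmod (fpart m f K t))\<^sup>2) \<le> of_int m * \<sigma>\<^sup>2" .
  then have "of_int m * (\<Sum>t\<in>{0..<m}. (cmod (fpart m f K t))\<^sup>2) \<le> of_int m * (of_int m * \<sigma>\<^sup>2)"
    using m by (intro mult_left_mono) auto
  moreover have "(\<Sum>t\<in>{0..<m}. cmod (fpart m f K t))\<^sup>2 \<le> of_int m * (\<Sum>t\<in>{0..<m}. (cmod (fpart m f K t))\<^sup>2)"
    using Cauchy_Schwarz_ineq_sum[of "\<lambda>_. 1" "\<lambda>t. cmod (fpart m f K t)" "{0..<m}"] m by simp
  ultimately have "(\<Sum>t\<in>{0..<m}. cmod (fpart m f K t))\<^sup>2 \<le> (of_int m * \<sigma>)\<^sup>2"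
    by (simp add: power2_eq_square mult_ac)
  then have "(\<Sum>t\<in>{0..<m}. cmod (fpart m f K t)) \<le> of_int m * \<sigma>"
    by (rule power2_le_imp_le) (use m \<open>\<sigma> \<ge> 0\<close> in auto)
  then show ?thesis
    using sum_shift_mod[OF m, of "\<lambda>t. cmod (fpart m f K t)" s] by (simp add: fpart_mod[OF m])
qed

text \<open>The value of f at the third point is traded for its value at t + d3. The part of f with
  frequencies in S changes by at most \<rho> by assumption, the part from S' - S is small in mean,
  and the remaining coefficients are uniformly small.\<close>

lemma counting_error:
  fixes f :: "int \<Rightarrow> real"
  assumes m: "m > 0" and lam: "coprime lam m" "coprime (1 - lam) m"
    and f: "\<And>x. 0 \<le> f x" "\<And>x. f x \<le> 1" and periodic: "\<And>x. f (x mod m) = f x"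
    and S: "S \<subseteq> S'" "S' \<subseteq> {0..<m}" and B: "B \<subseteq> {0..<m}"
    and "\<sigma> \<ge> 0" and energy: "(\<Sum>k\<in>S' - S. (cmod (fourier m f k))\<^sup>2) \<le> \<sigma>\<^sup>2"
    and "\<epsilon> \<ge> 0" and uniform: "\<And>k. k \<in> {0..<m} - S' \<Longrightarrow> cmod (fourier m f k) \<le> \<epsilon>"
    and bohr: "\<And>t d1 d2 d3. d1 \<in> B \<Longrightarrow> d2 \<in> B \<Longrightarrow> d3 \<in> B \<Longrightarrow>
      cmod (fpart m f S (t + lam * d1 + (1 - lam) * d2) - fpart m f S (t + d3)) \<le> \<rho>"
  defines "b \<equiv> real (card B)"
  shows "(\<Sum>t\<in>{0..<m}. (\<Sum>d\<in>B. f (t + d)) ^ 3)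
    \<le> b * (\<Sum>t\<in>{0..<m}. \<Sum>d1\<in>B. \<Sum>d2\<in>B. f (t + d1) * f (t + d2) * f (t + lam * d1 + (1 - lam) * d2))
      + of_int m * b ^ 3 * (\<rho> + 2 * \<sigma>) + 2 * \<epsilon> * (of_int m)\<^sup>2 * b\<^sup>2"
proof -
  have finB: "finite B"
    using B finite_subset by blast
  define w where "w t d1 d2 = complex_of_real (f (t + d1) * f (t + d2))" for t d1 d2
  have w: "cmod (w t d1 d2) \<le> 1" for t d1 d2
    unfolding w_def norm_of_real abs_mult using f by (intro mult_le_one) auto
  define q where "q t d1 d2 = t + lam * d1 + (1 - lam) * d2" for t d1 d2
  \<comment> \<open>The cost of this trade for a function g. It is linear in g, so the three parts
    of f can be estimated separately.\<close>
  define D where "D g = (\<Sum>d1\<in>B. \<Sum>d2\<in>B. \<Sum>d3\<in>B. \<Sum>t\<in>{0..<m}. w t d1 d2 * (g (q t d1 d2) - g (t + d3)))"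
    for g :: "int \<Rightarrow> complex"
  define Q where "Q = fpart m f (S' - S)"
  define W where "W = fpart m f ({0..<m} - S')"
  have "finite S'"
    using S(2) finite_subset by blast
  then have fin: "finite S'" "finite S"
    using S(1) finite_subset by auto
  have "complex_of_real (f x) = fpart m f S x + Q x + W x" for x
  proof -
    have "fpart m f ((S \<union> (S' - S)) \<union> ({0..<m} - S')) x = fpart m f (S \<union> (S' - S)) x + W x"
      unfolding W_def by (rule fpart_union) (use fin S in auto)
    moreover have "fpart m f (S \<union> (S' - S)) x = fpart m f S x + Q x"
      unfolding Q_def by (rule fpart_union) (use fin in auto)
    moreover have "(S \<union> (S' - S)) \<union> ({0..<m} - S') = {0..<m}"
      using S by auto
    ultimately show ?thesis
      by (simp add: fourier_inversion[of m f, OF m periodic])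
  qed
  moreover have "D (\<lambda>x. g x + h x) = D g + D h" for g h
    by (simp add: D_def add_diff_add distrib_left sum.distrib)
  ultimately have split: "D (\<lambda>x. complex_of_real (f x)) = D (fpart m f S) + D Q + D W"
    by simp
  have DP: "cmod (D (fpart m f S)) \<le> b * (b * (b * (of_int m * \<rho>)))"
    unfolding D_def b_def
  proof (intro sum_norm_bound)
    fix d1 d2 d3 assume d: "d1 \<in> B" "d2 \<in> B" "d3 \<in> B"
    have "cmod (\<Sum>t\<in>{0..<m}. w t d1 d2 * (fpart m f S (q t d1 d2) - fpart m f S (t + d3))) \<le> card {0..<m} * \<rho>"
    proof (intro sum_norm_bound)
      fix t
      have "cmod (fpart m f S (q t d1 d2) - fpart m f S (t + d3)) \<le> \<rho>"
        unfolding q_def by (rule bohr[OF d])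
      with w show "cmod (w t d1 d2 * (fpart m f S (q t d1 d2) - fpart m f S (t + d3))) \<le> \<rho>"
        unfolding norm_mult using mult_mono[of "cmod (w t d1 d2)" 1] by force
    qed
    then show "cmod (\<Sum>t\<in>{0..<m}. w t d1 d2 * (fpart m f S (q t d1 d2) - fpart m f S (t + d3))) \<le> of_int m * \<rho>"
      using m by simp
  qed
  \<comment> \<open>For fixed d1, d2, d3 both arguments are shifts of t, so the bound in mean
    applies to each.\<close>
  have DQ: "cmod (D Q) \<le> b * (b * (b * (of_int m * \<sigma> + of_int m * \<sigma>)))"
    unfolding D_def b_def
  proof (intro sum_norm_bound)
    fix d1 d2 d3 assume d: "d1 \<in> B" "d2 \<in> B" "d3 \<in> B"
    have "cmod (\<Sum>t\<in>{0..<m}. w t d1 d2 * (Q (q t d1 d2) - Q (t + d3)))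
        \<le> (\<Sum>t\<in>{0..<m}. cmod (Q (q t d1 d2)) + cmod (Q (t + d3)))"
    proof (intro sum_norm_le)
      fix t
      have "cmod (Q (q t d1 d2) - Q (t + d3)) \<le> cmod (Q (q t d1 d2)) + cmod (Q (t + d3))"
        by (rule norm_triangle_ineq4)
      with w show "cmod (w t d1 d2 * (Q (q t d1 d2) - Q (t + d3))) \<le> cmod (Q (q t d1 d2)) + cmod (Q (t + d3))"
        unfolding norm_mult using mult_mono[of "cmod (w t d1 d2)" 1] by force
    qed
    also have "\<dots> \<le> of_int m * \<sigma> + of_int m * \<sigma>"
      unfolding sum.distrib q_def Q_def add.assoc using S
      by (intro add_mono sum_norm_fpart_le m energy \<open>\<sigma> \<ge> 0\<close>) auto
    finally show "cmod (\<Sum>t\<in>{0..<m}. w t d1 d2 * (Q (q t d1 d2) - Q (t + d3))) \<le> of_int m * \<sigma> + of_int m * \<sigma>" .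
  qed
  define F where "F t = (\<Sum>d\<in>B. f (t + d))" for t
  have F: "0 \<le> F t" "F t \<le> b" for t
    using f sum_mono[of B "\<lambda>d. f (t + d)" "\<lambda>_. 1"] by (auto simp: F_def b_def intro: sum_nonneg)
  have sum_w: "(\<Sum>d1\<in>B. \<Sum>d2\<in>B. w t d1 d2) = of_real ((F t)\<^sup>2)" for t
    by (simp add: w_def F_def power2_eq_square sum_product)
  \<comment> \<open>In the first term d3 is free and yields the factor b; in the second the weights
    over d1 and d2 add up to \<open>(F t)\<^sup>2\<close>. These are the shapes of the bilinear and
    the linear estimate.\<close>
  have D_eq: "D g = of_real b * (\<Sum>t\<in>{0..<m}. \<Sum>d1\<in>B. \<Sum>d2\<in>B. w t d1 d2 * g (q t d1 d2))
      - (\<Sum>t\<in>{0..<m}. of_real ((F t)\<^sup>2) * (\<Sum>d\<in>B. g (t + d)))" for g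
  proof -
    have "D g = (\<Sum>d1\<in>B. \<Sum>d2\<in>B. \<Sum>d3\<in>B. \<Sum>t\<in>{0..<m}. w t d1 d2 * g (q t d1 d2))
      - (\<Sum>d1\<in>B. \<Sum>d2\<in>B. \<Sum>d3\<in>B. \<Sum>t\<in>{0..<m}. w t d1 d2 * g (t + d3))"
      by (simp add: D_def right_diff_distrib sum_subtractf)
    also have "(\<Sum>d1\<in>B. \<Sum>d2\<in>B. \<Sum>d3\<in>B. \<Sum>t\<in>{0..<m}. w t d1 d2 * g (q t d1 d2))
      = of_real b * (\<Sum>t\<in>{0..<m}. \<Sum>d1\<in>B. \<Sum>d2\<in>B. w t d1 d2 * g (q t d1 d2))"
      by (simp add: b_def sum.swap[of _ "{0..<m}"] sum_distrib_left)
    also have "(\<Sum>d1\<in>B. \<Sum>d2\<in>B. \<Sum>d3\<in>B. \<Sum>t\<in>{0..<m}. w t d1 d2 * g (t + d3))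
      = (\<Sum>t\<in>{0..<m}. \<Sum>d1\<in>B. \<Sum>d2\<in>B. w t d1 d2 * (\<Sum>d\<in>B. g (t + d)))"
      by (simp add: sum.swap[of _ "{0..<m}"] sum_distrib_left)
    also have "\<dots> = (\<Sum>t\<in>{0..<m}. of_real ((F t)\<^sup>2) * (\<Sum>d\<in>B. g (t + d)))"
      unfolding sum_w[symmetric] sum_distrib_right ..
    finally show ?thesis .
  qed
  have DW: "cmod (D W) \<le> b * (of_int m * (\<epsilon> * of_int m * b)) + b\<^sup>2 * (\<epsilon> * (of_int m)\<^sup>2)"
  proof -
    \<comment> \<open>For fixed t the weight is the product of f (t + d1) and f (t + d2), as the
      bilinear estimate requires.\<close>
    have "cmod (\<Sum>t\<in>{0..<m}. \<Sum>d1\<in>B. \<Sum>d2\<in>B. w t d1 d2 * W (q t d1 d2)) \<le> card {0..<m} * (\<epsilon> * of_int m * b)"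
      unfolding w_def W_def q_def b_def of_real_mult
      by (intro sum_norm_bound bilinear_fpart_le m lam B uniform \<open>\<epsilon> \<ge> 0\<close>) (use f in auto)
    then have "cmod (of_real b * (\<Sum>t\<in>{0..<m}. \<Sum>d1\<in>B. \<Sum>d2\<in>B. w t d1 d2 * W (q t d1 d2))) \<le> b * (of_int m * (\<epsilon> * of_int m * b))"
      using m by (simp add: norm_mult b_def mult_left_mono)
    moreover have "cmod (\<Sum>t\<in>{0..<m}. of_real ((F t)\<^sup>2) * (\<Sum>d\<in>B. W (t + d))) \<le> b\<^sup>2 * (\<epsilon> * (of_int m)\<^sup>2)"
    proof (cases "b = 0")
      case True
      then show ?thesis
        using finB by (simp add: b_def)
    next
      case False
      \<comment> \<open>The linear estimate wants weights of modulus at most 1, hence the division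
        by \<open>b\<^sup>2\<close>.\<close>
      have "cmod (\<Sum>t\<in>{0..<m}. of_real ((F t)\<^sup>2 / b\<^sup>2) * (\<Sum>d\<in>B. W (t + d))) \<le> \<epsilon> * (of_int m)\<^sup>2"
        unfolding W_def
      proof (intro linear_fpart_le m B uniform \<open>\<epsilon> \<ge> 0\<close>)
        show "cmod (complex_of_real ((F t)\<^sup>2 / b\<^sup>2)) \<le> 1" for t
          using F[of t] False by (simp add: norm_divide norm_power power_mono)
      qed auto
      then have "b\<^sup>2 * cmod (\<Sum>t\<in>{0..<m}. of_real ((F t)\<^sup>2 / b\<^sup>2) * (\<Sum>d\<in>B. W (t + d))) \<le> b\<^sup>2 * (\<epsilon> * (of_int m)\<^sup>2)"
        by (intro mult_left_mono) auto
      also have "b\<^sup>2 * cmod (\<Sum>t\<in>{0..<m}. of_real ((F t)\<^sup>2 / b\<^sup>2) * (\<Sum>d\<in>B. W (t + d)))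
          = cmod (of_real (b\<^sup>2) * (\<Sum>t\<in>{0..<m}. of_real ((F t)\<^sup>2 / b\<^sup>2) * (\<Sum>d\<in>B. W (t + d))))"
        by (simp only: norm_mult norm_of_real) simp
      also have "of_real (b\<^sup>2) * (\<Sum>t\<in>{0..<m}. of_real ((F t)\<^sup>2 / b\<^sup>2) * (\<Sum>d\<in>B. W (t + d)))
          = (\<Sum>t\<in>{0..<m}. of_real ((F t)\<^sup>2) * (\<Sum>d\<in>B. W (t + d)))"
        unfolding sum_distrib_left[of _ _ "{0..<m}"] using False by (intro sum.cong refl) simp
      finally show ?thesis .
    qed
    ultimately show ?thesis
      unfolding D_eq by (rule norm_triangle_le_diff[OF add_mono])
  qed
  define T where "T = (\<Sum>t\<in>{0..<m}. \<Sum>d1\<in>B. \<Sum>d2\<in>B. f (t + d1) * f (t + d2) * f (t + lam * d1 + (1 - lam) * d2))"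
  have "D (\<lambda>x. complex_of_real (f x)) = of_real (b * T - (\<Sum>t\<in>{0..<m}. F t ^ 3))"
    unfolding D_eq by (simp add: w_def q_def T_def F_def power2_eq_square power3_eq_cube)
  then have "(\<Sum>t\<in>{0..<m}. F t ^ 3) - b * T \<le> cmod (D (\<lambda>x. complex_of_real (f x)))"
    by (simp only: norm_of_real)
  also have "\<dots> \<le> b * (b * (b * (of_int m * \<rho>))) + b * (b * (b * (of_int m * \<sigma> + of_int m * \<sigma>)))
      + (b * (of_int m * (\<epsilon> * of_int m * b)) + b\<^sup>2 * (\<epsilon> * (of_int m)\<^sup>2))"
    unfolding split by (intro norm_triangle_le add_mono DP DQ DW)
  finally show ?thesis
    unfolding T_def F_def by (simp add: power2_eq_square power3_eq_cube algebra_simps)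
qed

text \<open>The sum of the cubes of the local sums is at least m (b \<mu>)^3, where b = |B|, and
  under the smallness assumptions each of the two errors takes at most a quarter of it. Half
  survives, and \<beta> m <= b turns the remaining b into m.\<close>

lemma pattern_sum_ge:
  fixes f :: "int \<Rightarrow> real"
  assumes m: "m > 0" and lam: "coprime lam m" "coprime (1 - lam) m"
    and f: "\<And>x. 0 \<le> f x" "\<And>x. f x \<le> 1" and periodic: "\<And>x. f (x mod m) = f x"
    and S: "S \<subseteq> S'" "S' \<subseteq> {0..<m}" and B: "B \<subseteq> {0..<m}"
    and "\<sigma> \<ge> 0" and energy: "(\<Sum>k\<in>S' - S. (cmod (fourier m f k))\<^sup>2) \<le> \<sigma>\<^sup>2"
    and "\<epsilon> \<ge> 0" and uniform: "\<And>k. k \<in> {0..<m} - S' \<Longrightarrow> cmod (fourier m f k) \<le> \<epsilon>"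
    and bohr: "\<And>t d1 d2 d3. d1 \<in> B \<Longrightarrow> d2 \<in> B \<Longrightarrow> d3 \<in> B \<Longrightarrow>
      cmod (fpart m f S (t + lam * d1 + (1 - lam) * d2) - fpart m f S (t + d3)) \<le> \<rho>"
    and \<mu>: "\<mu> > 0" and dense: "\<mu> * of_int m \<le> (\<Sum>x\<in>{0..<m}. f x)"
    and \<beta>: "\<beta> > 0" "\<beta> * of_int m \<le> real (card B)"
    and small: "\<rho> + 2 * \<sigma> \<le> \<mu> ^ 3 / 4" "\<epsilon> \<le> \<beta> * \<mu> ^ 3 / 8"
  shows "(\<Sum>u\<in>{0..<m}. \<Sum>v\<in>{0..<m}. f u * f v * f (lam * u + (1 - lam) * v)) \<ge> \<beta> * \<mu> ^ 3 / 2 * (of_int m)\<^sup>2"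
proof -
  define b where "b = real (card B)"
  define \<Lambda> where "\<Lambda> = (\<Sum>u\<in>{0..<m}. \<Sum>v\<in>{0..<m}. f u * f v * f (lam * u + (1 - lam) * v))"
  define T where "T = (\<Sum>t\<in>{0..<m}. \<Sum>d1\<in>B. \<Sum>d2\<in>B. f (t + d1) * f (t + d2) * f (t + lam * d1 + (1 - lam) * d2))"
  have "b > 0"
    using \<beta> m unfolding b_def by (smt (verit) mult_pos_pos of_int_0_less_iff)
  define G where "G u v = f u * f v * f (lam * u + (1 - lam) * v)" for u v
  have G: "0 \<le> G u v" for u v
    using f by (simp add: G_def)
  have periodic': "f x = f y" if "x mod m = y mod m" for x y
    by (metis periodic that)
  have G_mod: "G (u mod m) v = G u v" "G u (v mod m) = G u v" for u v
    unfolding G_def periodic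
    by (intro arg_cong2[of _ _ _ _ "(*)"] refl periodic' mod_add_cong mod_mult_right_eq)+
  \<comment> \<open>The points t + d1 and t + d2 have t + lam d1 + (1 - lam) d2 as their third
    point. For fixed d1, letting d2 run over all residues only adds nonnegative terms and makes the
    pair run over all pairs modulo m.\<close>
  have "T \<le> b * \<Lambda>"
  proof -
    have "T = (\<Sum>d1\<in>B. \<Sum>t\<in>{0..<m}. \<Sum>d2\<in>B. G (t + d1) (t + d2))"
      unfolding T_def G_def by (subst sum.swap) (simp add: algebra_simps)
    also have "\<dots> \<le> (\<Sum>d1\<in>B. \<Lambda>)"
    proof (rule sum_mono)
      fix d1
      have "(\<Sum>t\<in>{0..<m}. \<Sum>d2\<in>B. G (t + d1) (t + d2)) \<le> (\<Sum>t\<in>{0..<m}. \<Sum>d2\<in>{0..<m}. G (t + d1) (d2 + t))"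
        by (intro sum_mono, subst add.commute, intro sum_mono2) (use B G in \<open>auto simp: add.commute\<close>)
      also have "\<dots> = (\<Sum>t\<in>{0..<m}. \<Sum>v\<in>{0..<m}. G (t + d1) v)"
        by (intro sum.cong refl sum_shift_mod[OF m]) (rule G_mod)
      also have "\<dots> = (\<Sum>u\<in>{0..<m}. \<Sum>v\<in>{0..<m}. G u v)"
        by (intro sum_shift_mod[OF m, of "\<lambda>u. \<Sum>v\<in>{0..<m}. G u v"]) (simp add: G_mod)
      finally show "(\<Sum>t\<in>{0..<m}. \<Sum>d2\<in>B. G (t + d1) (t + d2)) \<le> \<Lambda>"
        by (simp add: \<Lambda>_def G_def)
    qed
    finally show ?thesis
      by (simp add: b_def)
  qed
  define F where "F t = (\<Sum>d\<in>B. f (t + d))" for t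
  have F0: "F t \<ge> 0" for t
    unfolding F_def using f by (intro sum_nonneg) auto
  define c where "c = b * \<mu>"
  have "c \<ge> 0"
    using \<open>b > 0\<close> \<mu> by (simp add: c_def)
  have sumF: "of_int m * c \<le> (\<Sum>t\<in>{0..<m}. F t)"
  proof -
    have "(\<Sum>t\<in>{0..<m}. F t) = (\<Sum>d\<in>B. \<Sum>t\<in>{0..<m}. f (t + d))"
      unfolding F_def by (rule sum.swap)
    also have "\<dots> = b * (\<Sum>t\<in>{0..<m}. f t)"
      by (simp add: sum_shift_mod[OF m, of f] periodic b_def)
    finally show ?thesis
      using dense \<open>b > 0\<close> mult_left_mono[of "\<mu> * of_int m" "\<Sum>x\<in>{0..<m}. f x" b] by (simp add: c_def mult_ac)
  qed
  \<comment> \<open>The cube lies above its tangent at \<open>c\<close>.\<close>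
  have "of_int m * c ^ 3 = 3 * c\<^sup>2 * (of_int m * c) - of_int m * (2 * c ^ 3)"
    by (simp add: power2_eq_square power3_eq_cube)
  also have "\<dots> \<le> 3 * c\<^sup>2 * (\<Sum>t\<in>{0..<m}. F t) - of_int m * (2 * c ^ 3)"
    using sumF by (intro diff_right_mono mult_left_mono) auto
  also have "\<dots> = (\<Sum>t\<in>{0..<m}. 3 * c\<^sup>2 * F t - 2 * c ^ 3)"
    using m by (simp add: sum_subtractf sum_distrib_left)
  also have "\<dots> \<le> (\<Sum>t\<in>{0..<m}. F t ^ 3)"
  proof (rule sum_mono)
    fix t
    have "F t ^ 3 - (3 * c\<^sup>2 * F t - 2 * c ^ 3) = (F t - c)\<^sup>2 * (F t + 2 * c)"
      by (simp add: power2_eq_square power3_eq_cube algebra_simps)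
    moreover have "\<dots> \<ge> 0"
      using F0[of t] \<open>c \<ge> 0\<close> by simp
    ultimately show "3 * c\<^sup>2 * F t - 2 * c ^ 3 \<le> F t ^ 3"
      by linarith
  qed
  also have "\<dots> \<le> b * T + of_int m * b ^ 3 * (\<rho> + 2 * \<sigma>) + 2 * \<epsilon> * (of_int m)\<^sup>2 * b\<^sup>2"
    unfolding F_def T_def b_def by (rule counting_error[OF assms(1-14)])
  also have "\<dots> \<le> b * (b * \<Lambda>) + of_int m * b ^ 3 * (\<mu> ^ 3 / 4) + b ^ 3 * of_int m * (\<mu> ^ 3 / 4)"
  proof (intro add_mono mult_left_mono \<open>T \<le> b * \<Lambda>\<close> small)
    \<comment> \<open>Here \<epsilon> has to be small relative to \<beta>: this error has one factor
      b fewer than the main term, and \<beta> m <= b restores it.\<close>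
    have "2 * \<epsilon> * (of_int m)\<^sup>2 * b\<^sup>2 \<le> 2 * (\<beta> * \<mu> ^ 3 / 8) * (of_int m)\<^sup>2 * b\<^sup>2"
      using small by (intro mult_right_mono) auto
    also have "\<dots> = (\<beta> * of_int m) * (of_int m * b\<^sup>2 * (\<mu> ^ 3 / 4))"
      by (simp add: power2_eq_square)
    also have "\<dots> \<le> b * (of_int m * b\<^sup>2 * (\<mu> ^ 3 / 4))"
      using \<beta> m \<mu> by (intro mult_right_mono) (auto simp: b_def)
    also have "\<dots> = b ^ 3 * of_int m * (\<mu> ^ 3 / 4)"
      by (simp add: power2_eq_square power3_eq_cube)
    finally show "2 * \<epsilon> * (of_int m)\<^sup>2 * b\<^sup>2 \<le> b ^ 3 * of_int m * (\<mu> ^ 3 / 4)" .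
  qed (use m \<open>b > 0\<close> in auto)
  finally have "b\<^sup>2 * (of_int m * b * \<mu> ^ 3 / 2) \<le> b\<^sup>2 * \<Lambda>"
    by (simp add: c_def power_mult_distrib power2_eq_square power3_eq_cube algebra_simps)
  then have "of_int m * b * \<mu> ^ 3 / 2 \<le> \<Lambda>"
    using \<open>b > 0\<close> by simp
  moreover have "of_int m * (\<beta> * of_int m) * \<mu> ^ 3 / 2 \<le> of_int m * b * \<mu> ^ 3 / 2"
    using \<beta> m \<mu> by (intro divide_right_mono mult_right_mono mult_left_mono) (auto simp: b_def)
  ultimately show ?thesis
    by (simp add: \<Lambda>_def power2_eq_square mult_ac)
qed

subsection \<open>Choice of the scale\<close>

definition spectrum :: "int \<Rightarrow> (int \<Rightarrow> real) \<Rightarrow> real \<Rightarrow> int set" where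
  "spectrum m f \<epsilon> = {k\<in>{0..<m}. \<epsilon> \<le> cmod (fourier m f k)}"

lemma finite_spectrum: "finite (spectrum m f \<epsilon>)"
  unfolding spectrum_def by (rule finite_subset[of _ "{0..<m}"]) auto

lemma sum_norm_fourier_le_1:
  assumes m: "m > 0" and f: "\<And>x. 0 \<le> f x" "\<And>x. f x \<le> 1" and K: "K \<subseteq> {0..<m}"
  shows "(\<Sum>k\<in>K. (cmod (fourier m f k))\<^sup>2) \<le> 1"
proof -
  have "(\<Sum>k\<in>K. (cmod (fourier m f k))\<^sup>2) \<le> (\<Sum>k\<in>{0..<m}. (cmod (fourier m f k))\<^sup>2)"
    using K by (intro sum_mono2) auto
  also have "\<dots> = (\<Sum>x\<in>{0..<m}. (f x)\<^sup>2) / of_int m"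
    by (rule sum_norm_fourier[OF m])
  also have "\<dots> \<le> (\<Sum>x\<in>{0..<m}. 1) / of_int m"
    using f m by (intro divide_right_mono sum_mono) (auto simp: power_le_one)
  finally show ?thesis
    using m by simp
qed

text \<open>Chebyshev's inequality for the energy; the bound does not involve m.\<close>

lemma card_spectrum_le:
  assumes m: "m > 0" and f: "\<And>x. 0 \<le> f x" "\<And>x. f x \<le> 1" and "\<epsilon> > 0"
  shows "real (card (spectrum m f \<epsilon>)) \<le> 1 / \<epsilon>\<^sup>2"
proof -
  have "real (card (spectrum m f \<epsilon>)) * \<epsilon>\<^sup>2 = (\<Sum>k\<in>spectrum m f \<epsilon>. \<epsilon>\<^sup>2)"
    by simp
  also have "\<dots> \<le> (\<Sum>k\<in>spectrum m f \<epsilon>. (cmod (fourier m f k))\<^sup>2)"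
    using \<open>\<epsilon> > 0\<close> by (intro sum_mono power_mono) (auto simp: spectrum_def)
  also have "\<dots> \<le> 1"
    by (intro sum_norm_fourier_le_1 m f) (auto simp: spectrum_def)
  finally show ?thesis
    using \<open>\<epsilon> > 0\<close> by (simp add: field_simps)
qed

text \<open>The order of quantifiers matters: \<beta> depends on \<rho> and \<epsilon> alone,
  because the size of the spectrum is bounded independently of m and f.\<close>

lemma bohr_set_spectrum:
  assumes "\<rho> > 0" "\<epsilon> > 0"
  obtains \<beta> :: real where "\<beta> > 0"
    "\<And>m lam f. m > 0 \<Longrightarrow> (\<And>x. 0 \<le> f x) \<Longrightarrow> (\<And>x. f x \<le> 1) \<Longrightarrow>
      \<exists>B\<subseteq>{0..<m}. \<beta> * of_int m \<le> real (card B) \<and>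
        (\<forall>t. \<forall>d1\<in>B. \<forall>d2\<in>B. \<forall>d3\<in>B. cmod (fpart m f (spectrum m f \<epsilon>) (t + lam * d1 + (1 - lam) * d2)
          - fpart m f (spectrum m f \<epsilon>) (t + d3)) \<le> \<rho>)"
proof -
  define r where "r = nat \<lceil>1 / \<epsilon>\<^sup>2\<rceil>"
  obtain n0 :: nat where n0: "8 * pi * real r / \<rho> < real n0"
    using reals_Archimedean2 by blast
  define n where "n = Suc n0"
  have n: "8 * pi * real r / real n \<le> \<rho>" "n > 0"
  proof -
    have "8 * pi * real r / \<rho> < real n"
      using n0 by (simp add: n_def)
    then show "8 * pi * real r / real n \<le> \<rho>"
      using \<open>\<rho> > 0\<close> by (simp add: field_simps n_def)
  qed (simp add: n_def)
  show thesis
  proof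
    show "1 / real n ^ (2 * r) > 0"
      using n by simp
  next
    fix m lam :: int and f :: "int \<Rightarrow> real"
    assume m: "m > 0" and f: "\<And>x. 0 \<le> f x" "\<And>x. f x \<le> 1"
    define S where "S = spectrum m f \<epsilon>"
    have fin: "finite S"
      by (simp add: S_def finite_spectrum)
    have "real (card S) \<le> 1 / \<epsilon>\<^sup>2"
      unfolding S_def by (rule card_spectrum_le[OF m f \<open>\<epsilon> > 0\<close>])
    then have cardS: "card S \<le> r"
      unfolding r_def by linarith
    \<comment> \<open>The phases to control are k lam d1, k d2, k lam d2 and k d3 for k in
      S.\<close>
    define Q where "Q = S \<union> (*) lam ` S"
    have "card Q \<le> card S + card ((*) lam ` S)"
      unfolding Q_def by (rule card_Un_le)
    also have "\<dots> \<le> 2 * r"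
      using cardS card_image_le[OF fin, of "(*) lam"] by simp
    finally have cardQ: "card Q \<le> 2 * r" .
    obtain B where B: "B \<subseteq> {0..<m}" "m \<le> int (card B * n ^ card Q)"
      "\<And>q d. q \<in> Q \<Longrightarrow> d \<in> B \<Longrightarrow> cmod (chi m (q * d) - 1) \<le> 2 * pi / real n"
      using bohr_set[OF m n(2), of Q] fin unfolding Q_def by blast
    have "of_int m \<le> real (card B) * real n ^ card Q"
      using B(2) by (metis of_int_le_iff of_int_of_nat_eq of_nat_mult of_nat_power)
    also have "\<dots> \<le> real (card B) * real n ^ (2 * r)"
      using cardQ n by (intro mult_left_mono power_increasing) auto
    finally have dense: "1 / real n ^ (2 * r) * of_int m \<le> real (card B)"
      using n by (simp add: field_simps)
    have "cmod (fpart m f S (t + lam * d1 + (1 - lam) * d2) - fpart m f S (t + d3)) \<le> \<rho>"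
      if d: "d1 \<in> B" "d2 \<in> B" "d3 \<in> B" for t d1 d2 d3
    proof -
      have "cmod (fpart m f S (t + lam * d1 + (1 - lam) * d2) - fpart m f S (t + d3)) \<le> real (card S) * (8 * pi / real n)"
        unfolding fpart_def sum_subtractf[symmetric]
      proof (rule sum_norm_bound)
        fix k assume k: "k \<in> S"
        have "(cmod (fourier m f k))\<^sup>2 \<le> 1"
          using sum_norm_fourier_le_1[OF m f, of "{k}"] k by (simp add: S_def spectrum_def)
        then have fk: "cmod (fourier m f k) \<le> 1"
          using power2_le_imp_le[of "cmod (fourier m f k)" 1] by simp
        define x1 where "x1 = chi m ((lam * k) * d1)"
        define x2 where "x2 = chi m (k * d2)"
        define x3 where "x3 = chi m ((lam * k) * d2)"
        define x4 where "x4 = chi m (k * d3)"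
        have x: "cmod (x1 - 1) \<le> 2 * pi / n" "cmod (x2 - 1) \<le> 2 * pi / n"
          "cmod (x3 - 1) \<le> 2 * pi / n" "cmod (x4 - 1) \<le> 2 * pi / n"
          unfolding x1_def x2_def x3_def x4_def using k d by (auto intro!: B(3) simp: Q_def)
        have x_norm: "cmod x1 = 1" "cmod x2 = 1" "cmod x3 = 1" "cmod x4 = 1"
          by (simp_all add: x1_def x2_def x3_def x4_def)
        have c3: "cmod (cnj x3 - 1) = cmod (x3 - 1)"
          by (metis complex_cnj_diff complex_cnj_one complex_mod_cnj)
        \<comment> \<open>The character at k (1 - lam) d2 splits into x2 and the conjugate of
          x3.\<close>
        have "fourier m f k * chi m (k * (t + lam * d1 + (1 - lam) * d2)) - fourier m f k * chi m (k * (t + d3))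
          = fourier m f k * chi m (k * t) * (x1 * x2 * cnj x3 - x4)"
          unfolding x1_def x2_def x3_def x4_def cnj_chi mult.assoc right_diff_distrib
          by (simp add: chi_add[symmetric] algebra_simps)
        then have "cmod (fourier m f k * chi m (k * (t + lam * d1 + (1 - lam) * d2)) - fourier m f k * chi m (k * (t + d3)))
          = cmod (fourier m f k) * cmod (x1 * x2 * cnj x3 - x4)"
          by (simp add: norm_mult)
        also have "\<dots> \<le> cmod (x1 * x2 * cnj x3 - x4)"
          using mult_right_mono[OF fk norm_ge_zero[of "x1 * x2 * cnj x3 - x4"]] by simp
        \<comment> \<open>Telescoping: the characters are replaced by 1 one at a time.\<close>
        also have "x1 * x2 * cnj x3 - x4 = x1 * x2 * (cnj x3 - 1) + x1 * (x2 - 1) + (x1 - 1) - (x4 - 1)"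
          by (simp add: algebra_simps)
        also have "cmod \<dots> \<le> cmod (x1 * x2 * (cnj x3 - 1)) + cmod (x1 * (x2 - 1)) + cmod (x1 - 1) + cmod (x4 - 1)"
          by (intro norm_triangle_le_diff norm_triangle_le add_mono order_refl)
        also have "\<dots> = cmod (x3 - 1) + cmod (x2 - 1) + cmod (x1 - 1) + cmod (x4 - 1)"
          by (simp add: norm_mult x_norm c3)
        also have "\<dots> \<le> 8 * pi / n"
          using x by simp
        finally show "cmod (fourier m f k * chi m (k * (t + lam * d1 + (1 - lam) * d2)) - fourier m f k * chi m (k * (t + d3)))
          \<le> 8 * pi / n" .
      qed
      also have "\<dots> \<le> real r * (8 * pi / real n)"
        using cardS by (intro mult_right_mono) auto
      also have "\<dots> \<le> \<rho>"
        using n by (simp add: mult_ac)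
      finally show ?thesis .
    qed
    then show "\<exists>B\<subseteq>{0..<m}. 1 / real n ^ (2 * r) * of_int m \<le> real (card B) \<and>
        (\<forall>t. \<forall>d1\<in>B. \<forall>d2\<in>B. \<forall>d3\<in>B. cmod (fpart m f (spectrum m f \<epsilon>) (t + lam * d1 + (1 - lam) * d2)
          - fpart m f (spectrum m f \<epsilon>) (t + d3)) \<le> \<rho>)"
      using B(1) dense unfolding S_def by blast
  qed
qed

text \<open>The spectra grow with i, so the J layers between consecutive ones are disjoint and share
  an energy of at most 1; they cannot all exceed \<sigma>^2.\<close>

lemma spectral_gap:
  assumes m: "m > 0" and f: "\<And>x. 0 \<le> f x" "\<And>x. f x \<le> 1"
    and J: "1 < real J * \<sigma>\<^sup>2" and decr: "\<And>i. E (Suc i) \<le> E i"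
  obtains i where "i < J"
    "(\<Sum>k\<in>spectrum m f (E (Suc i)) - spectrum m f (E i). (cmod (fourier m f k))\<^sup>2) \<le> \<sigma>\<^sup>2"
proof -
  define S where "S i = spectrum m f (E i)" for i
  define en where "en K = (\<Sum>k\<in>K. (cmod (fourier m f k))\<^sup>2)" for K
  have mono: "S i \<subseteq> S (Suc i)" for i
    using decr[of i] by (auto simp: S_def spectrum_def)
  have "(\<Sum>i<j. en (S (Suc i) - S i)) \<le> en (S j)" for j
  proof (induction j)
    case 0
    show ?case
      by (simp add: en_def sum_nonneg)
  next
    case (Suc j)
    have "en (S (Suc j)) = en (S (Suc j) - S j) + en (S j)"
      unfolding en_def using mono[of j] by (intro sum.subset_diff) (auto simp: S_def finite_spectrum)
    with Suc.IH show ?case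
      by simp
  qed
  also have "en (S J) \<le> 1"
    unfolding en_def S_def by (intro sum_norm_fourier_le_1 m f) (auto simp: spectrum_def)
  finally have "(\<Sum>i<J. en (S (Suc i) - S i)) < (\<Sum>i<J. \<sigma>\<^sup>2)"
    using J by simp
  then obtain i where "i < J" "en (S (Suc i) - S i) \<le> \<sigma>\<^sup>2"
    by (smt (verit) lessThan_iff sum_mono)
  then show thesis
    using that unfolding en_def S_def by blast
qed

text \<open>To keep \<delta> independent of m, \<open>lam\<close> and f, all thresholds and Bohr
  densities are fixed beforehand; the given data only select one of finitely many scales.\<close>

theorem cyclic_pattern_count:
  fixes \<mu> :: real
  assumes \<mu>: "\<mu> > 0"
  shows "\<exists>\<delta>::real. \<delta> > 0 \<and> (\<forall>m lam f. m > 0 \<longrightarrow> coprime lam m \<longrightarrow> coprime (1 - lam) m \<longrightarrow>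
      (\<forall>x. 0 \<le> f x \<and> f x \<le> 1 \<and> f (x mod m) = f x) \<longrightarrow> \<mu> * of_int m \<le> (\<Sum>x\<in>{0..<m}. f x) \<longrightarrow>
      \<delta> * (of_int m)\<^sup>2 \<le> (\<Sum>u\<in>{0..<m}. \<Sum>v\<in>{0..<m}. f u * f v * f (lam * u + (1 - lam) * v)))"
proof -
  \<comment> \<open>These values give \<rho> + 2 \<sigma> = \<mu>^3 / 4.\<close>
  define \<sigma> where "\<sigma> = \<mu> ^ 3 / 16"
  define \<rho> where "\<rho> = \<mu> ^ 3 / 8"
  have \<sigma>: "\<sigma> > 0" and \<rho>: "\<rho> > 0"
    using \<mu> by (simp_all add: \<sigma>_def \<rho>_def)
  \<comment> \<open>Packaging the Bohr set statement lets \<beta> be chosen as a function of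
    \<epsilon> before m and f appear.\<close>
  define good where "good \<epsilon> \<beta> \<longleftrightarrow> \<beta> > 0 \<and> (\<forall>m lam f. m > 0 \<longrightarrow> (\<forall>x. 0 \<le> f x) \<longrightarrow> (\<forall>x. f x \<le> 1) \<longrightarrow>
      (\<exists>B\<subseteq>{0..<m}. \<beta> * of_int m \<le> real (card B) \<and>
        (\<forall>t. \<forall>d1\<in>B. \<forall>d2\<in>B. \<forall>d3\<in>B. cmod (fpart m f (spectrum m f \<epsilon>) (t + lam * d1 + (1 - lam) * d2)
          - fpart m f (spectrum m f \<epsilon>) (t + d3)) \<le> \<rho>)))" for \<epsilon> \<beta> :: real
  have "\<exists>\<beta>. good \<epsilon> \<beta>" if "\<epsilon> > 0" for \<epsilon>
    using bohr_set_spectrum[OF \<rho> that] unfolding good_def by metis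
  then obtain \<beta> where \<beta>: "\<And>\<epsilon>. \<epsilon> > 0 \<Longrightarrow> good \<epsilon> (\<beta> \<epsilon>)"
    by metis
  \<comment> \<open>Each threshold is small compared with the Bohr density at the preceding one, as
    the error from the small coefficients demands; \<open>min\<close> keeps the sequence from
    increasing.\<close>
  define E where "E i = ((\<lambda>\<epsilon>. min \<epsilon> (\<beta> \<epsilon> * \<mu> ^ 3 / 8)) ^^ i) 1" for i
  have E_Suc: "E (Suc i) = min (E i) (\<beta> (E i) * \<mu> ^ 3 / 8)" for i
    by (simp add: E_def)
  have E: "E i > 0" for i
  proof (induction i)
    case (Suc i)
    then show ?case
      using \<beta>[of "E i"] \<mu> unfolding E_Suc good_def by simp
  qed (simp add: E_def)
  obtain J0 :: nat where "1 / \<sigma>\<^sup>2 < real J0"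
    using reals_Archimedean2 by blast
  then obtain J :: nat where J: "1 / \<sigma>\<^sup>2 < real J" "J > 0"
    by (metis \<sigma> not_gr_zero of_nat_0 order_less_asym zero_less_divide_1_iff zero_less_power)
  \<comment> \<open>Only scales i < J are ever selected, so a minimum of finitely many positive
    constants works; J > 0 makes the set nonempty.\<close>
  define \<delta> where "\<delta> = Min ((\<lambda>i. \<beta> (E i) * \<mu> ^ 3 / 2) ` {..<J})"
  show ?thesis
  proof (intro exI[of _ \<delta>] conjI allI impI)
    show "\<delta> > 0"
      unfolding \<delta>_def using J(2) \<beta> E \<mu> by (subst Min_gr_iff) (auto simp: good_def)
  next
    fix m lam :: int and f :: "int \<Rightarrow> real"
    assume m: "m > 0" and lam: "coprime lam m" "coprime (1 - lam) m"
      and f_all: "\<forall>x. 0 \<le> f x \<and> f x \<le> 1 \<and> f (x mod m) = f x"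
      and dense: "\<mu> * of_int m \<le> (\<Sum>x\<in>{0..<m}. f x)"
    from f_all have f: "\<And>x. 0 \<le> f x" "\<And>x. f x \<le> 1" and periodic: "\<And>x. f (x mod m) = f x"
      by auto
    have "1 < real J * \<sigma>\<^sup>2"
      using J \<sigma> by (simp add: field_simps)
    then obtain i where i: "i < J"
      "(\<Sum>k\<in>spectrum m f (E (Suc i)) - spectrum m f (E i). (cmod (fourier m f k))\<^sup>2) \<le> \<sigma>\<^sup>2"
      by (rule spectral_gap[OF m f, of J \<sigma> E]) (auto simp: E_Suc)
    obtain B where B: "B \<subseteq> {0..<m}" "\<beta> (E i) * of_int m \<le> real (card B)"
      "\<And>t d1 d2 d3. d1 \<in> B \<Longrightarrow> d2 \<in> B \<Longrightarrow> d3 \<in> B \<Longrightarrow>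
        cmod (fpart m f (spectrum m f (E i)) (t + lam * d1 + (1 - lam) * d2)
          - fpart m f (spectrum m f (E i)) (t + d3)) \<le> \<rho>"
      using \<beta>[OF E, of i] m f unfolding good_def by metis
    have "\<beta> (E i) * \<mu> ^ 3 / 2 * (of_int m)\<^sup>2
        \<le> (\<Sum>u\<in>{0..<m}. \<Sum>v\<in>{0..<m}. f u * f v * f (lam * u + (1 - lam) * v))"
    proof (rule pattern_sum_ge[OF m lam f periodic _ _ B(1) _ i(2) _ _ B(3) \<mu> dense _ B(2)])
      show "spectrum m f (E i) \<subseteq> spectrum m f (E (Suc i))"
        by (auto simp: spectrum_def E_Suc)
      show "spectrum m f (E (Suc i)) \<subseteq> {0..<m}"
        by (auto simp: spectrum_def)
      show "cmod (fourier m f k) \<le> E (Suc i)" if "k \<in> {0..<m} - spectrum m f (E (Suc i))" for k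
        using that by (auto simp: spectrum_def)
      show "\<rho> + 2 * \<sigma> \<le> \<mu> ^ 3 / 4"
        by (simp add: \<rho>_def \<sigma>_def)
      show "E (Suc i) \<le> \<beta> (E i) * \<mu> ^ 3 / 8"
        by (simp add: E_Suc)
      show "\<beta> (E i) > 0"
        using \<beta>[OF E] by (simp add: good_def)
      show "\<sigma> \<ge> 0" "E (Suc i) \<ge> 0"
        using \<sigma> E[of "Suc i"] by auto
    qed
    moreover have "\<delta> \<le> \<beta> (E i) * \<mu> ^ 3 / 2"
      unfolding \<delta>_def using i(1) by (intro Min_le) auto
    then have "\<delta> * (of_int m)\<^sup>2 \<le> \<beta> (E i) * \<mu> ^ 3 / 2 * (of_int m)\<^sup>2"
      by (rule mult_right_mono) simp
    ultimately show "\<delta> * (of_int m)\<^sup>2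
        \<le> (\<Sum>u\<in>{0..<m}. \<Sum>v\<in>{0..<m}. f u * f v * f (lam * u + (1 - lam) * v))"
      by linarith
  qed
qed

subsection \<open>Transfer to the plane\<close>

lemma pair_pmf_of_set:
  assumes "finite A" "A \<noteq> {}" "finite B" "B \<noteq> {}"
  shows "pair_pmf (pmf_of_set A) (pmf_of_set B) = pmf_of_set (A \<times> B)"
proof (rule pmf_eqI)
  fix x :: "'a \<times> 'b"
  show "pmf (pair_pmf (pmf_of_set A) (pmf_of_set B)) x = pmf (pmf_of_set (A \<times> B)) x"
    using assms by (cases x) (simp add: pmf_pair card_cartesian_product indicator_def)
qed

lemma prob_iid_uniform4:
  "measure_pmf.prob (iid_uniform4 N) X
    = card ((sym_interval N \<times> sym_interval N \<times> sym_interval N \<times> sym_interval N) \<inter> X) / (2 * real N + 1) ^ 4"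
proof -
  have "real (card (sym_interval N)) = 2 * real N + 1"
    by (simp add: sym_interval_eq)
  then show ?thesis
    by (simp add: iid_uniform4_def pair_pmf_of_set measure_pmf_of_set card_cartesian_product
      power4_eq_xxxx mult.assoc)
qed

theorem theorem3:
  fixes \<mu> :: real
  assumes "\<mu> > 0"
  shows "\<exists>\<delta>::real. \<delta> > 0 \<and>
    (\<forall>(N::nat) (R :: (int \<times> int) set).
       N > 0 \<longrightarrow>
       R \<subseteq> sym_interval N \<times> sym_interval N \<longrightarrow>
       real (card R) / (2 * real N + 1)\<^sup>2 \<ge> \<mu> \<longrightarrow>
       measure_pmf.prob (iid_uniform4 N)
         {(a1, b1, a2, b2).
            (a1, b1) \<in> R \<and> (a2, b2) \<in> R \<and> (a1 + b1 - b2, a2 + b2 - a1) \<in> R} \<ge> \<delta>)"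
proof -
  \<comment> \<open>The modulus will satisfy m <= 100 N^2 <= 25 (2N + 1)^2, so the image of R has
    density at least \<mu> / 25 modulo m.\<close>
  have "\<mu> / 25 > 0"
    using assms by simp
  from cyclic_pattern_count[OF this] obtain \<delta> :: real where "\<delta> > 0" and
    \<delta>: "\<forall>m lam f. m > 0 \<longrightarrow> coprime lam m \<longrightarrow> coprime (1 - lam) m \<longrightarrow>
      (\<forall>x. 0 \<le> f x \<and> f x \<le> 1 \<and> f (x mod m) = f x) \<longrightarrow> \<mu> / 25 * of_int m \<le> (\<Sum>x\<in>{0..<m}. f x) \<longrightarrow>
      \<delta> * (of_int m)\<^sup>2 \<le> (\<Sum>u\<in>{0..<m}. \<Sum>v\<in>{0..<m}. f u * f v * f (lam * u + (1 - lam) * v))"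
    by (elim exE conjE) (rule that)
  show ?thesis
  proof (intro exI[of _ \<delta>] conjI allI impI \<open>\<delta> > 0\<close>)
    fix N :: nat and R :: "(int \<times> int) set"
    assume "N > 0" and R: "R \<subseteq> sym_interval N \<times> sym_interval N"
      and dense: "\<mu> \<le> real (card R) / (2 * real N + 1)\<^sup>2"
    \<comment> \<open>The factor 10 leaves room: 4N < K and 4N (K + 1) < m, so \<phi> separates
      modulo m points whose coordinates differ by at most 4N.\<close>
    define K where "K = 10 * int N"
    define m where "m = K\<^sup>2 - K + 1"
    define \<phi> where "\<phi> a b = K * a + b" for a b
    have N1: "1 \<le> int N" "int N \<le> (int N)\<^sup>2"
      using \<open>N > 0\<close> by (simp_all add: power2_eq_square)
    have m_eq: "m = 100 * (int N)\<^sup>2 - 10 * int N + 1"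
      by (simp add: m_def K_def power2_eq_square)
    have "m > 0"
      using N1 unfolding m_eq by linarith
    \<comment> \<open>The upper bound controls the density of the image; the lower one turns m^2
      into (2N + 1)^4 at the end.\<close>
    have m_bounds: "m \<le> 100 * (int N)\<^sup>2" "(2 * int N + 1)\<^sup>2 \<le> m"
      using N1 by (auto simp: m_eq power2_eq_square algebra_simps)
    have coprime: "coprime K m" "coprime (1 - K) m"
    proof -
      have "is_unit c" if "c dvd x" "c dvd m" "m - x * y = 1" for c x y
        by (metis dvd_diff dvd_mult2 that)
      moreover have "m - K * (K - 1) = 1" "m - (1 - K) * (- K) = 1"
        by (simp_all add: m_def power2_eq_square algebra_simps)
      ultimately show "coprime K m" "coprime (1 - K) m"
        by (meson coprimeI)+
    qed
    \<comment> \<open>The coordinates of the third point are at most \<open>3 N\<close>, so they differ from those of a point of \<open>R\<close> by at most \<open>4 N\<close>.\<close>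
    have \<phi>_inj: "a = a' \<and> b = b'" if "m dvd \<phi> a b - \<phi> a' b'" "\<bar>a - a'\<bar> \<le> 4 * int N" "\<bar>b - b'\<bar> \<le> 4 * int N" for a b a' b'
    proof -
      define x y where "x = a - a'" and "y = b - b'"
      have xy: "\<bar>x\<bar> \<le> 4 * int N" "\<bar>y\<bar> \<le> 4 * int N"
        using that by (auto simp: x_def y_def)
      have "\<bar>K * x + y\<bar> \<le> K * \<bar>x\<bar> + \<bar>y\<bar>"
        using abs_triangle_ineq[of "K * x" y] by (simp add: abs_mult K_def)
      also have "\<dots> \<le> K * (4 * int N) + 4 * int N"
        using xy by (intro add_mono mult_left_mono) (auto simp: K_def)
      also have "\<dots> < m"
        using N1 by (simp add: m_eq K_def power2_eq_square)
      finally have "\<bar>K * x + y\<bar> < m" .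
      moreover have "m dvd K * x + y"
        using that(1) by (simp add: \<phi>_def x_def y_def algebra_simps)
      ultimately have 0: "K * x + y = 0"
        using dvd_imp_le_int \<open>m > 0\<close> by force
      \<comment> \<open>Otherwise |y| = K |x| >= 10 N, which exceeds 4 N.\<close>
      have "x = 0"
      proof (rule ccontr)
        assume "x \<noteq> 0"
        then have "K * 1 \<le> K * \<bar>x\<bar>"
          by (intro mult_left_mono) (auto simp: K_def)
        also have "\<dots> = \<bar>y\<bar>"
        proof -
          have "y = - (K * x)"
            using 0 by linarith
          then show ?thesis
            by (simp add: abs_mult K_def)
        qed
        finally show False
          using xy N1 by (simp add: K_def)
      qed
      with 0 show ?thesis
        by (simp add: x_def y_def)
    qed
    have finR: "finite R"
      using R by (rule finite_subset) simp
    have R_bound: "\<bar>a\<bar> \<le> int N" "\<bar>b\<bar> \<le> int N" if "(a, b) \<in> R" for a b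
      using that R by (auto simp: sym_interval_def)
    define \<psi> where "\<psi> = (\<lambda>(a, b). \<phi> a b mod m)"
    define A where "A = \<psi> ` R"
    have A: "A \<subseteq> {0..<m}"
      using \<open>m > 0\<close> by (auto simp: A_def \<psi>_def)
    have "inj_on \<psi> R"
    proof (rule inj_onI)
      fix p q assume "p \<in> R" "q \<in> R" "\<psi> p = \<psi> q"
      moreover obtain a b a' b' where "p = (a, b)" "q = (a', b')"
        by (metis surj_pair)
      moreover from calculation have "\<bar>a - a'\<bar> \<le> 4 * int N" "\<bar>b - b'\<bar> \<le> 4 * int N"
        using R_bound[of a b] R_bound[of a' b'] by auto
      ultimately show "p = q"
        using \<phi>_inj[of a b a' b'] by (simp add: \<psi>_def mod_eq_dvd_iff)
    qed
    then have cardA: "card A = card R"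
      unfolding A_def by (rule card_image)
    define f :: "int \<Rightarrow> real" where "f x = of_bool (x mod m \<in> A)" for x
    have "(\<Sum>x\<in>{0..<m}. f x) = (\<Sum>x\<in>{0..<m}. of_bool (x \<in> A))"
      by (intro sum.cong) (auto simp: f_def)
    also have "\<dots> = card A"
      using A by (simp add: Int_absorb1)
    finally have sumf: "(\<Sum>x\<in>{0..<m}. f x) = card R"
      by (simp add: cardA)
    define Z where "Z = {p \<in> R \<times> R. case p of ((a1, b1), (a2, b2)) \<Rightarrow> (a1 + b1 - b2, a2 + b2 - a1) \<in> R}"
    define Y where "Y = {(u, v) \<in> A \<times> A. (K * u + (1 - K) * v) mod m \<in> A}"
    have "finite Z"
      unfolding Z_def by (rule finite_subset[of _ "R \<times> R"]) (use finR in auto)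
    \<comment> \<open>Every solution modulo m lifts to one in the plane, so the cyclic count bounds
      the planar count from below.\<close>
    have "Y \<subseteq> map_prod \<psi> \<psi> ` Z"
    proof clarify
      fix u v assume "(u, v) \<in> Y"
      then have uv: "u \<in> A" "v \<in> A" "(K * u + (1 - K) * v) mod m \<in> A"
        by (auto simp: Y_def)
      obtain a1 b1 where 1: "(a1, b1) \<in> R" "u = \<psi> (a1, b1)"
        using uv(1) by (auto simp: A_def)
      obtain a2 b2 where 2: "(a2, b2) \<in> R" "v = \<psi> (a2, b2)"
        using uv(2) by (auto simp: A_def)
      obtain a3 b3 where 3: "(a3, b3) \<in> R" "(K * u + (1 - K) * v) mod m = \<psi> (a3, b3)"
        using uv(3) by (auto simp: A_def)
      have "(K * u + (1 - K) * v) mod m = (K * \<phi> a1 b1 + (1 - K) * \<phi> a2 b2) mod m"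
        unfolding 1 2 \<psi>_def by (simp, intro mod_add_cong mod_mult_right_eq)
      \<comment> \<open>The difference of the two values is (K^2 - K + 1) (a1 - a2); this is why m
        is that polynomial in K.\<close>
      also have "K * \<phi> a1 b1 + (1 - K) * \<phi> a2 b2 = \<phi> (a1 + b1 - b2) (a2 + b2 - a1) + m * (a1 - a2)"
        by (simp add: \<phi>_def m_def power2_eq_square algebra_simps)
      finally have "m dvd \<phi> (a1 + b1 - b2) (a2 + b2 - a1) - \<phi> a3 b3"
        using 3 unfolding mod_eq_dvd_iff[symmetric] by (simp add: \<psi>_def)
      then have "a1 + b1 - b2 = a3 \<and> a2 + b2 - a1 = b3"
        by (rule \<phi>_inj) (use R_bound[OF 1(1)] R_bound[OF 2(1)] R_bound[OF 3(1)] in auto)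
      then have "((a1, b1), (a2, b2)) \<in> Z"
        using 1 2 3 by (simp add: Z_def)
      then show "(u, v) \<in> map_prod \<psi> \<psi> ` Z"
        using 1 2 by force
    qed
    then have card_YZ: "card Y \<le> card Z"
      using \<open>finite Z\<close> by (metis card_image_le card_mono finite_imageI le_trans)
    have card_Y: "(\<Sum>u\<in>{0..<m}. \<Sum>v\<in>{0..<m}. f u * f v * f (K * u + (1 - K) * v)) = card Y"
    proof -
      have "(\<Sum>u\<in>{0..<m}. \<Sum>v\<in>{0..<m}. f u * f v * f (K * u + (1 - K) * v))
          = (\<Sum>p\<in>{0..<m} \<times> {0..<m}. of_bool (p \<in> Y))"
        unfolding sum.cartesian_product by (intro sum.cong) (auto simp: f_def Y_def)
      also have "\<dots> = card (({0..<m} \<times> {0..<m}) \<inter> Y)"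
        by (simp add: Collect_mem_eq)
      also have "({0..<m} \<times> {0..<m}) \<inter> Y = Y"
        using A by (auto simp: Y_def)
      finally show ?thesis .
    qed
    have "\<mu> / 25 * of_int m \<le> \<mu> / 25 * (100 * (real N)\<^sup>2)"
    proof (rule mult_left_mono)
      have "real_of_int m \<le> real_of_int (100 * (int N)\<^sup>2)"
        using m_bounds(1) unfolding of_int_le_iff .
      then show "real_of_int m \<le> 100 * (real N)\<^sup>2"
        by simp
    qed (use assms in simp)
    also have "\<dots> \<le> \<mu> * (2 * real N + 1)\<^sup>2"
      using assms by (simp add: power2_eq_square algebra_simps)
    also have "\<dots> \<le> card R"
      using dense by (simp add: field_simps)
    finally have "\<mu> / 25 * of_int m \<le> (\<Sum>x\<in>{0..<m}. f x)"
      by (simp add: sumf)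
    then have "\<delta> * (of_int m)\<^sup>2 \<le> card Y"
      unfolding card_Y[symmetric]
      by (intro \<delta>[rule_format] \<open>m > 0\<close> coprime) (auto simp: f_def)
    have "(2 * real N + 1)\<^sup>2 \<le> of_int m"
    proof -
      have "real_of_int ((2 * int N + 1)\<^sup>2) \<le> real_of_int m"
        using m_bounds(2) unfolding of_int_le_iff .
      then show ?thesis
        by simp
    qed
    then have "((2 * real N + 1)\<^sup>2)\<^sup>2 \<le> (of_int m)\<^sup>2"
      by (intro power_mono) auto
    then have "\<delta> * (2 * real N + 1) ^ 4 \<le> \<delta> * (of_int m)\<^sup>2"
      using \<open>\<delta> > 0\<close> by (simp add: power_mult[symmetric])
    also note \<open>\<delta> * (of_int m)\<^sup>2 \<le> card Y\<close>
    also have "real (card Y) \<le> card Z"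
      using card_YZ by simp
    finally have Z: "\<delta> * (2 * real N + 1) ^ 4 \<le> card Z" .
    let ?X = "{(a1, b1, a2, b2). (a1, b1) \<in> R \<and> (a2, b2) \<in> R \<and> (a1 + b1 - b2, a2 + b2 - a1) \<in> R}"
    let ?I = "sym_interval N"
    \<comment> \<open>Only the bracketing of the quadruple changes; membership in R already puts the
      coordinates in the interval.\<close>
    have "bij_betw (\<lambda>((a1, b1), (a2, b2)). (a1, b1, a2, b2)) Z ((?I \<times> ?I \<times> ?I \<times> ?I) \<inter> ?X)"
      by (rule bij_betw_byWitness[where f' = "\<lambda>(a1, b1, a2, b2). ((a1, b1), (a2, b2))"])
        (auto simp: Z_def sym_interval_def dest: R_bound)
    then have "card Z = card ((?I \<times> ?I \<times> ?I \<times> ?I) \<inter> ?X)"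
      by (rule bij_betw_same_card)
    moreover have "\<delta> \<le> real (card Z) / (2 * real N + 1) ^ 4"
      using Z by (subst le_divide_eq) auto
    ultimately show "\<delta> \<le> measure_pmf.prob (iid_uniform4 N) ?X"
      unfolding prob_iid_uniform4 by (simp only:)
  qed
qed

end
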